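(* Let $0<\mu\le 1$ and let $d$ be a positive integer. Then there is a constant $C=C(\mu,d)\ge 1$ such that the following holds. Let $k\ge 2$ be an integer and let $\mathbf v=\{v_1,\dots,v_n\}$ be a multiset of integers such that $\mathbb P_\mu(\mathbf v)\ge C(\mu,d)\,k^{-d}$. Then there exists a $k$-dissociated multiset $\mathbf w=\{w_1,\dots,w_r\}$ such that: (1) $r\le d-1$ and $w_1,\dots,w_r$ are elements of $\mathbf v$; (2) the union $\bigcup_{\tau\in\mathbb Z,\,1\le\tau\le k}\frac1\tau\cdot Q(\mathbf w,k)$ contains all but at most $k^2$ of the integers $v_1,\dots,v_n$ (counting multiplicity).
   Context: For $0\le\mu\le1$, $\eta^\mu$ is a random variable equal to $0$ with probability $1-\mu$ and to $+1$, $-1$ with probability $\mu/2$ each. For a multiset $\mathbf v=\{v_1,\dots,v_n\}$ of integers, $\mathbb P_\mu(\mathbf v):=\max_{a\in\mathbb Z}\mathbf P(\sum_{i=1}^n\eta_i^\mu v_i=a)$, where the $\eta^\mu_i$ are i.i.d. copies of $\eta^\mu$. For a multiset $\mathbf w=\{w_1,\dots,w_r\}$ of real numbers and $k>0$, $Q(\mathbf w,k):=\{m_1w_1+\dots+m_rw_r: m_i\in\mathbb Z,\ -k\le m_i\le k\}$ (equal to $\{0\}$ if $r=0$). The multiset $\mathbf w$ is $k$-dissociated if there do not exist integers $-k\le m_1,\dots,m_r\le k$, not all zero, such that $m_1w_1+\dots+m_rw_r=0$. For a real number $c$ and a set $A$ of reals, $c\cdot A:=\{ca: a\in A\}$. 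*)

theory Defs
  imports "HOL-Probability.Probability" "HOL-Library.Set_Algebras"
begin

definition eta_pmf :: "real \<Rightarrow> int pmf" where
  "eta_pmf \<mu> =
     embed_pmf (\<lambda>x. if x = 0 then 1 - \<mu> else if x = 1 \<or> x = - 1 then \<mu> / 2 else 0)"

lemma pmf_eta_pmf:
  assumes "0 \<le> \<mu>" "\<mu> \<le> 1"
  shows "pmf (eta_pmf \<mu>) x =
    (if x = 0 then 1 - \<mu> else if x = 1 \<or> x = - 1 then \<mu> / 2 else 0)"
  unfolding eta_pmf_def
proof (rule pmf_embed_pmf)
  let ?f = "\<lambda>x::int. if x = 0 then 1 - \<mu> else if x = 1 \<or> x = - 1 then \<mu> / 2 else 0"
  show "0 \<le> ?f x" for x
    using assms by auto
  have "(\<integral>\<^sup>+ x. ennreal (?f x) \<partial>count_space UNIV) =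
        (\<Sum>x\<in>{0, 1, - 1}. ennreal (?f x))"
    by (rule nn_integral_count_space') auto
  also have "\<dots> = ennreal (\<Sum>x\<in>{0, 1, - 1}. ?f x)"
    using assms by (intro sum_ennreal) auto
  also have "(\<Sum>x\<in>{0, 1, - 1}. ?f x) = 1"
    by simp
  finally show "(\<integral>\<^sup>+ x. ennreal (?f x) \<partial>count_space UNIV) = 1"
    by simp
qed

text \<open>
  Multisets are given by enumerations, i.e. lists, whose order is immaterial below. The
  coordinates of the product distribution on functions are the i.i.d. copies of the step variable
  (the second argument of \<^const>\<open>Pi_pmf\<close> is only a default value outside the index set).
\<close>

definition walk_prob :: "real \<Rightarrow> int list \<Rightarrow> int \<Rightarrow> real" where
  "walk_prob \<mu> v a =
     measure_pmf.prob (Pi_pmf {..<length v} 0 (\<lambda>_. eta_pmf \<mu>))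
       {\<eta>. (\<Sum>i<length v. \<eta> i * v ! i) = a}"

definition max_prob :: "real \<Rightarrow> int list \<Rightarrow> real" where
  "max_prob \<mu> v = Max (range (walk_prob \<mu> v))"

text \<open>The maximum is over a finite set of values, so it is well defined.\<close>

lemma finite_range_walk_prob:
  assumes "0 \<le> \<mu>" "\<mu> \<le> 1"
  shows "finite (range (walk_prob \<mu> v))"
proof -
  let ?M = "Pi_pmf {..<length v} 0 (\<lambda>_. eta_pmf \<mu>)"
  let ?s = "\<lambda>\<eta>. \<Sum>i<length v. \<eta> i * v ! i"
  have "set_pmf (eta_pmf \<mu>) \<subseteq> {0, 1, - 1}"
    using assms by (auto simp: set_pmf_iff pmf_eta_pmf split: if_splits)
  then have "finite (set_pmf (eta_pmf \<mu>))"
    by (rule finite_subset) simp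
  then have fin: "finite (set_pmf ?M)"
    by (simp add: set_Pi_pmf finite_PiE_dflt)
  have "walk_prob \<mu> v a = 0" if "a \<notin> ?s ` set_pmf ?M" for a
    unfolding walk_prob_def measure_pmf_zero_iff using that by auto
  then have "range (walk_prob \<mu> v) \<subseteq> insert 0 (walk_prob \<mu> v ` ?s ` set_pmf ?M)"
    by blast
  then show ?thesis
    by (rule finite_subset) (use fin in simp)
qed

definition Q_set :: "real list \<Rightarrow> real \<Rightarrow> real set" where
  "Q_set w k =
     {\<Sum>i<length w. of_int (m i) * w ! i | m :: nat \<Rightarrow> int.
        \<forall>i<length w. - k \<le> of_int (m i) \<and> of_int (m i) \<le> k}"

definition dissociated :: "real \<Rightarrow> real list \<Rightarrow> bool" where
  "dissociated k w \<longleftrightarrow>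
     \<not> (\<exists>m :: nat \<Rightarrow> int.
          (\<forall>i<length w. - k \<le> of_int (m i) \<and> of_int (m i) \<le> k) \<and>
          (\<exists>i<length w. m i \<noteq> 0) \<and>
          (\<Sum>i<length w. of_int (m i) * w ! i) = 0)"

end

theory Submission
  imports Defs
begin

text \<open>
  Write $e_N(x) = \exp(2 \pi i x / N)$. Fourier inversion on the integers modulo $N$ bounds
  $P_\mu(v)$ by the mean, over the frequencies $\xi < N$, of
  $\prod_j |1 - \mu + \mu \cos(2 \pi \xi v_j / N)|$. Each factor is at most $G_\xi(v_j)^d$, where
  $G_\xi(y) = 1 - \beta |1 - e_N(2 \xi y)|^2$ and $\beta = \mu / (8 d)$
  (\<open>walk_prob_le_power_mean\<close>). So $P_\mu(v)$ is bounded by a mean over $\xi$ that contains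
  $d$ copies of every factor $G_\xi(v_j)$, all of them in $[0,1]$.

  The tuple $w$ is grown greedily, spending one of the $d$ copies of $v$ at each step
  (\<open>greedy_selection\<close>). As long as more than $k^2$ of the $v_j$ extend $w$ to a
  $k$-dissociated tuple, take $k^2$ of these and discard the other factors of that copy, which
  can only increase the mean. By the inequality of arithmetic and geometric means, one of the
  selected elements can replace all of them: the mean does not decrease if their factors become
  the single power $G_\xi(v_j)^{k^2}$. That $v_j$ is appended to $w$. Since a full copy of $v$ is
  available at every step, the elements set aside earlier are not lost to the later counts, and
  this is why the exceptional set has size $k^2$ rather than a multiple of it.

  If the process halts with fewer than $d$ elements, then all but at most $k^2$ of the $v_j$ satisfy
  a nontrivial relation with $w$ with coefficients bounded by $k$. The coefficient $\tau$ of $v_j$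
  is nonzero because $w$ is $k$-dissociated, and dividing by it places $v_j$ in
  $\frac{1}{|\tau|} Q(w, k)$ (\<open>not_dissociated_snocD\<close>).

  Otherwise it reaches a $k$-dissociated $w$ of length $d$, and $P_\mu(v)$ is at most the mean of
  $\prod_{i<d} G_\xi(w_i)^{k^2}$. Each factor is a bump of width about $1/k$ and is dominated
  by a trigonometric polynomial of degree less than $k$ with constant term $O(1/k)$
  (\<open>power_le_kernel\<close>). In the mean of the product of these polynomials only the
  product of the constant terms survives, because the other frequencies are nontrivial relations
  among the $w_i$ (\<open>mean_prod_trig_poly\<close>). So $P_\mu(v) \le (128 d / (\mu k))^d$, which
  is excluded once $C > (128 d / \mu)^d$.
\<close>

section \<open>Additive characters modulo N\<close>

definition root_char :: "nat \<Rightarrow> int \<Rightarrow> complex" where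
  "root_char N x = cis (2 * pi * of_int x / of_nat N)"

lemma norm_root_char [simp]: "norm (root_char N x) = 1"
  by (simp add: root_char_def)

lemma root_char_add: "root_char N (x + y) = root_char N x * root_char N y"
  by (simp add: root_char_def cis_mult add_divide_distrib ring_distribs)

lemma root_char_0 [simp]: "root_char N 0 = 1"
  by (simp add: root_char_def)

lemma root_char_minus: "root_char N (- x) = cnj (root_char N x)"
  by (simp add: root_char_def cis_cnj)

lemma root_char_power: "root_char N x ^ j = root_char N (int j * x)"
  by (induction j) (simp_all add: root_char_add ring_distribs)

lemma root_char_sum: "root_char N (\<Sum>i\<in>A. f i) = (\<Prod>i\<in>A. root_char N (f i))"
  by (induction A rule: infinite_finite_induct) (simp_all add: root_char_add)

lemma root_char_eq_1_iff:
  assumes "N > 0"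
  shows "root_char N x = 1 \<longleftrightarrow> int N dvd x"
proof
  assume "root_char N x = 1"
  then have "cos (2 * pi * of_int x / of_nat N) = 1"
    by (metis cis.sel(1) one_complex.sel(1) root_char_def)
  then obtain n :: int where "2 * pi * of_int x / of_nat N = of_int n * 2 * pi"
    unfolding cos_one_2pi_int by blast
  then have "real_of_int x = of_int (n * int N)"
    using assms by (simp add: field_simps)
  then have "x = n * int N"
    by (simp only: of_int_eq_iff)
  then show "int N dvd x"
    by simp
next
  assume "int N dvd x"
  then obtain n where "x = int N * n" ..
  then have "2 * pi * of_int x / of_nat N = 2 * pi * of_int n"
    using assms by simp
  then show "root_char N x = 1"
    unfolding root_char_def by (simp only: cis_multiple_2pi Ints_of_int)
qed

lemma sum_root_char:
  assumes "N > 0"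
  shows "(\<Sum>\<xi><N. root_char N (int \<xi> * x)) = (if int N dvd x then of_nat N else 0)"
proof -
  have "(\<Sum>\<xi><N. root_char N (int \<xi> * x)) = (\<Sum>\<xi><N. root_char N x ^ \<xi>)"
    by (simp add: root_char_power)
  also have "\<dots> = (if int N dvd x then of_nat N else 0)"
  proof (cases "int N dvd x")
    case True
    then have "root_char N x = 1"
      using root_char_eq_1_iff[OF assms] by blast
    then show ?thesis using True by simp
  next
    case False
    then have "root_char N x \<noteq> 1"
      using root_char_eq_1_iff[OF assms] by blast
    moreover have "root_char N x ^ N = 1"
      unfolding root_char_power using root_char_eq_1_iff[OF assms] by simp
    ultimately show ?thesis using False by (simp add: sum_gp_strict)
  qed
  finally show ?thesis .
qed

section \<open>Fourier bound for the concentration probability\<close>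

lemma expectation_eta_pmf:
  fixes f :: "int \<Rightarrow> 'b::{banach, second_countable_topology}"
  assumes "0 \<le> \<mu>" "\<mu> \<le> 1"
  shows "measure_pmf.expectation (eta_pmf \<mu>) f =
    (1 - \<mu>) *\<^sub>R f 0 + (\<mu> / 2) *\<^sub>R (f 1 + f (- 1))"
proof -
  have "set_pmf (eta_pmf \<mu>) \<subseteq> {0, 1, - 1}"
    using assms by (auto simp: set_pmf_iff pmf_eta_pmf split: if_splits)
  then show ?thesis
    by (subst integral_measure_pmf[of "{0, 1, - 1}"])
      (auto simp: pmf_eta_pmf assms scaleR_add_right)
qed

lemma expectation_root_char_eta:
  assumes "0 \<le> \<mu>" "\<mu> \<le> 1"
  shows "measure_pmf.expectation (eta_pmf \<mu>) (\<lambda>e. root_char N (e * x)) =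
    of_real (1 - \<mu> + \<mu> * Re (root_char N x))"
proof -
  have "root_char N x + root_char N (- x) = of_real (2 * Re (root_char N x))"
    by (simp add: root_char_minus complex_add_cnj)
  then show ?thesis
    using assms by (simp add: expectation_eta_pmf scaleR_conv_of_real)
qed

lemma expectation_root_char_walk:
  fixes x :: "nat \<Rightarrow> int"
  assumes "0 \<le> \<mu>" "\<mu> \<le> 1"
  shows "measure_pmf.expectation (Pi_pmf {..<n} 0 (\<lambda>_. eta_pmf \<mu>))
      (\<lambda>\<eta>. root_char N (\<Sum>i<n. \<eta> i * x i)) =
    (\<Prod>i<n. of_real (1 - \<mu> + \<mu> * Re (root_char N (x i))))"
proof -
  let ?M = "Pi_pmf {..<n} 0 (\<lambda>_. eta_pmf \<mu>)"
  have ind: "prob_space.indep_vars ?M (\<lambda>_. borel) (\<lambda>i \<eta>. root_char N (\<eta> i * x i)) {..<n}"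
    by (rule prob_space.indep_vars_compose2[OF prob_space_measure_pmf indep_vars_Pi_pmf[OF finite_lessThan],
        where Y = "\<lambda>i e. root_char N (e * x i)"]) auto
  have comp: "measure_pmf.expectation ?M (\<lambda>\<eta>. root_char N (\<eta> i * x i)) =
      of_real (1 - \<mu> + \<mu> * Re (root_char N (x i)))" if "i < n" for i
  proof -
    have "measure_pmf.expectation ?M (\<lambda>\<eta>. root_char N (\<eta> i * x i)) =
      measure_pmf.expectation (map_pmf (\<lambda>\<eta>. \<eta> i) ?M) (\<lambda>e. root_char N (e * x i))"
      by simp
    also have "map_pmf (\<lambda>\<eta>. \<eta> i) ?M = eta_pmf \<mu>"
      using that by (subst Pi_pmf_component) auto
    finally show ?thesis
      using expectation_root_char_eta[OF assms] by simp
  qed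
  have "measure_pmf.expectation ?M (\<lambda>\<eta>. \<Prod>i<n. root_char N (\<eta> i * x i)) =
      (\<Prod>i<n. measure_pmf.expectation ?M (\<lambda>\<eta>. root_char N (\<eta> i * x i)))"
    using ind by (intro prob_space.indep_vars_lebesgue_integral[OF prob_space_measure_pmf])
      (auto intro!: measure_pmf.integrable_const_bound[where B = 1])
  then show ?thesis
    using comp by (simp add: root_char_sum)
qed

text \<open>
  The walk hits $a$ no more often than it hits the residue class of $a$ modulo $N$, and the
  indicator of that class is the mean of the characters. Hence $N$ may be chosen freely here.
\<close>

lemma walk_prob_le_fourier:
  assumes "0 \<le> \<mu>" "\<mu> \<le> 1" "N > 0"
  shows "walk_prob \<mu> v a \<le>
    (\<Sum>\<xi><N. \<Prod>i<length v. \<bar>1 - \<mu> + \<mu> * Re (root_char N (int \<xi> * v ! i))\<bar>) / real N"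
proof -
  let ?M = "Pi_pmf {..<length v} 0 (\<lambda>_. eta_pmf \<mu>)"
  let ?S = "\<lambda>\<eta>. \<Sum>i<length v. \<eta> i * v ! i"
  let ?B = "{\<eta>. int N dvd ?S \<eta> - a}"
  have int: "integrable ?M (\<lambda>\<eta>. root_char N (f \<eta>))" for f
    by (rule measure_pmf.integrable_const_bound[where B = 1]) auto
  \<comment> \<open>The probability is viewed as a complex number, so that the triangle inequality can be applied
    to its Fourier expansion.\<close>
  have "walk_prob \<mu> v a \<le> measure_pmf.prob ?M ?B"
    unfolding walk_prob_def by (rule measure_pmf.finite_measure_mono) auto
  also have "\<dots> = norm (of_real (measure_pmf.prob ?M ?B) :: complex)"
    by simp
  also have "(of_real (measure_pmf.prob ?M ?B) :: complex) =
      measure_pmf.expectation ?M (\<lambda>\<eta>. of_real (indicator ?B \<eta>))"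
    by simp
  also have "\<dots> = measure_pmf.expectation ?M
      (\<lambda>\<eta>. (\<Sum>\<xi><N. root_char N (int \<xi> * (?S \<eta> - a))) / of_nat N)"
    using assms by (intro Bochner_Integration.integral_cong) (auto simp: sum_root_char)
  also have "\<dots> = (\<Sum>\<xi><N. measure_pmf.expectation ?M
      (\<lambda>\<eta>. root_char N (int \<xi> * (?S \<eta> - a)))) / of_nat N"
    using int by simp
  also have "norm \<dots> \<le> (\<Sum>\<xi><N. norm (measure_pmf.expectation ?M
      (\<lambda>\<eta>. root_char N (int \<xi> * (?S \<eta> - a))))) / real N"
    by (simp add: norm_divide divide_right_mono norm_sum)
  also have "\<dots> = (\<Sum>\<xi><N. \<Prod>i<length v. \<bar>1 - \<mu> + \<mu> * Re (root_char N (int \<xi> * v ! i))\<bar>) / real N"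
  proof (intro arg_cong2[where f = "(/)"] sum.cong refl)
    fix \<xi>
    have "root_char N (int \<xi> * (?S \<eta> - a)) =
        root_char N (\<Sum>i<length v. \<eta> i * (int \<xi> * v ! i)) * root_char N (- (int \<xi> * a))" for \<eta>
      by (simp add: root_char_add [symmetric] ring_distribs sum_distrib_left mult.left_commute)
    then have "measure_pmf.expectation ?M (\<lambda>\<eta>. root_char N (int \<xi> * (?S \<eta> - a))) =
        (\<Prod>i<length v. of_real (1 - \<mu> + \<mu> * Re (root_char N (int \<xi> * v ! i)))) *
        root_char N (- (int \<xi> * a))"
      by (simp only: integral_mult_left_zero expectation_root_char_walk[OF assms(1,2)])
    then show "norm (measure_pmf.expectation ?M (\<lambda>\<eta>. root_char N (int \<xi> * (?S \<eta> - a)))) =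
        (\<Prod>i<length v. \<bar>1 - \<mu> + \<mu> * Re (root_char N (int \<xi> * v ! i))\<bar>)"
      by (simp only: norm_mult norm_root_char mult_1_right norm_of_real flip: prod_norm)
  qed
  finally show ?thesis .
qed

text \<open>
  For $z = e^{i \theta}$ the left-hand side is $|1 - \mu + \mu \cos \theta|$, which for large $\mu$
  is close to $1$ also near $\theta = \pi$. Passing to the doubled angle, whose distance to $1$
  vanishes at both points, gives a bound without the absolute value, and Bernoulli's inequality
  turns it into a $d$-th power.
\<close>

lemma abs_step_char_le_power:
  fixes z :: complex
  assumes "0 \<le> \<mu>" "\<mu> \<le> 1" "norm z = 1" "d > 0"
  shows "\<bar>1 - \<mu> + \<mu> * Re z\<bar> \<le> (1 - \<mu> / (8 * real d) * (norm (1 - z\<^sup>2))\<^sup>2) ^ d"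
proof -
  define c where "c = Re z"
  have z: "c\<^sup>2 + (Im z)\<^sup>2 = 1"
    using assms(3) by (simp add: c_def cmod_def)
  then have c: "\<bar>c\<bar> \<le> 1"
    by (metis abs_le_square_iff abs_one le_add_same_cancel1 one_power2 zero_le_power2)
  have cc: "1 - z\<^sup>2 = Complex (2 * (Im z)\<^sup>2) (- 2 * c * Im z)"
    using z by (simp add: complex_eq_iff power2_eq_square c_def)
  have "(norm (1 - z\<^sup>2))\<^sup>2 = 4 * (Im z)\<^sup>2 * (c\<^sup>2 + (Im z)\<^sup>2)"
    unfolding cc cmod_power2 by (simp add: power2_eq_square algebra_simps)
  then have n: "(norm (1 - z\<^sup>2))\<^sup>2 = 4 * (1 - c\<^sup>2)"
    using z by simp
  have "1 - \<mu> + \<mu> * c \<le> 1 - \<mu> / 2 * (1 - c\<^sup>2)"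
  proof -
    have "0 \<le> \<mu> / 2 * (1 - c)\<^sup>2" using assms by simp
    then show ?thesis by (simp add: power2_eq_square field_simps)
  qed
  moreover have "- (1 - \<mu> + \<mu> * c) \<le> 1 - \<mu> / 2 * (1 - c\<^sup>2)"
  proof -
    have "0 \<le> \<mu> / 2 * (1 + c)\<^sup>2" using assms by simp
    then show ?thesis using assms by (simp add: power2_eq_square field_simps)
  qed
  ultimately have "\<bar>1 - \<mu> + \<mu> * c\<bar> \<le> 1 - \<mu> / 2 * (1 - c\<^sup>2)"
    by linarith
  also have "\<dots> = 1 + real d * (- (\<mu> / (8 * real d) * (norm (1 - z\<^sup>2))\<^sup>2))"
    using assms by (simp add: n field_simps)
  also have "\<dots> \<le> (1 + (- (\<mu> / (8 * real d) * (norm (1 - z\<^sup>2))\<^sup>2))) ^ d"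
  proof (rule Bernoulli_inequality)
    have "\<mu> * (1 - c\<^sup>2) \<le> 1 * 1"
      using assms c by (intro mult_mono) (auto simp: abs_square_le_1)
    moreover have "1 \<le> real d" using assms by simp
    ultimately show "- 1 \<le> - (\<mu> / (8 * real d) * (norm (1 - z\<^sup>2))\<^sup>2)"
      using assms by (simp add: n field_simps)
  qed
  finally show ?thesis by (simp add: c_def)
qed

lemma walk_prob_le_power_mean:
  assumes "0 < \<mu>" "\<mu> \<le> 1" "d > 0" "N > 0"
  shows "walk_prob \<mu> v a \<le>
    (\<Sum>\<xi><N. (\<Prod>i<length v. 1 - \<mu> / (8 * real d) * (norm (1 - root_char N (int \<xi> * (2 * v ! i))))\<^sup>2) ^ d) / real N"
proof -
  have "walk_prob \<mu> v a \<le>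
      (\<Sum>\<xi><N. \<Prod>i<length v. \<bar>1 - \<mu> + \<mu> * Re (root_char N (int \<xi> * v ! i))\<bar>) / real N"
    using assms by (intro walk_prob_le_fourier) auto
  also have "\<dots> \<le> (\<Sum>\<xi><N. \<Prod>i<length v.
      (1 - \<mu> / (8 * real d) * (norm (1 - (root_char N (int \<xi> * v ! i))\<^sup>2))\<^sup>2) ^ d) / real N"
    using assms by (intro divide_right_mono sum_mono prod_mono conjI abs_step_char_le_power) auto
  also have "\<dots> = (\<Sum>\<xi><N. (\<Prod>i<length v.
      1 - \<mu> / (8 * real d) * (norm (1 - root_char N (int \<xi> * (2 * v ! i))))\<^sup>2) ^ d) / real N"
    by (simp add: root_char_power prod_power_distrib mult.left_commute)
  finally show ?thesis .
qed

section \<open>Greedy selection of a dissociated tuple\<close>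

lemma prod_le_average_power:
  fixes a :: "'a \<Rightarrow> real"
  assumes "finite B" "B \<noteq> {}" "\<And>j. j \<in> B \<Longrightarrow> a j \<ge> 0"
  shows "(\<Prod>j\<in>B. a j) \<le> (\<Sum>j\<in>B. a j ^ card B) / card B"
proof -
  have pos: "card B > 0" using assms by (simp add: card_gt_0_iff)
  have "(\<Prod>j\<in>B. a j ^ card B) powr (1 / card B) = (\<Prod>j\<in>B. a j)"
  proof -
    have "(\<Prod>j\<in>B. a j ^ card B) = (\<Prod>j\<in>B. a j) ^ card B"
      by (simp add: prod_power_distrib)
    moreover have "(\<Prod>j\<in>B. a j) \<ge> 0" using assms by (simp add: prod_nonneg)
    ultimately show ?thesis using pos
      by (cases "(\<Prod>j\<in>B. a j) = 0") (simp_all add: powr_powr flip: powr_realpow)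
  qed
  then show ?thesis
    using arith_geom_mean[of B "\<lambda>j. a j ^ card B"] assms by (simp add: sum_divide_distrib)
qed

text \<open>
  This plays the part of Hoelder's inequality for a product of $|B|$ functions: only the existence
  of one good factor is needed, and for that the pointwise inequality of arithmetic and geometric
  means is enough.
\<close>

lemma exists_dominating_factor:
  fixes a :: "'x \<Rightarrow> 'a \<Rightarrow> real"
  assumes "finite B" "B \<noteq> {}"
    and "\<And>x j. x \<in> X \<Longrightarrow> j \<in> B \<Longrightarrow> a x j \<ge> 0" and "\<And>x. x \<in> X \<Longrightarrow> g x \<ge> 0"
  shows "\<exists>j\<in>B. (\<Sum>x\<in>X. g x * (\<Prod>j\<in>B. a x j)) \<le> (\<Sum>x\<in>X. g x * a x j ^ card B)"
proof (rule ccontr)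
  assume "\<not> ?thesis"
  then have less: "(\<Sum>x\<in>X. g x * a x j ^ card B) < (\<Sum>x\<in>X. g x * (\<Prod>j\<in>B. a x j))" if "j \<in> B" for j
    using that by force
  have pos: "card B > 0" using assms by (simp add: card_gt_0_iff)
  have "(\<Sum>x\<in>X. g x * (\<Prod>j\<in>B. a x j)) \<le> (\<Sum>x\<in>X. g x * ((\<Sum>j\<in>B. a x j ^ card B) / card B))"
    using assms by (intro sum_mono mult_left_mono prod_le_average_power) auto
  also have "\<dots> = (\<Sum>j\<in>B. \<Sum>x\<in>X. g x * a x j ^ card B) / card B"
    by (subst sum.swap) (simp add: sum_distrib_left sum_divide_distrib)
  also have "\<dots> < (\<Sum>j\<in>B. \<Sum>x\<in>X. g x * (\<Prod>j\<in>B. a x j)) / card B"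
    using pos by (intro divide_strict_right_mono sum_strict_mono[OF assms(1,2) less]) auto
  also have "\<dots> = (\<Sum>x\<in>X. g x * (\<Prod>j\<in>B. a x j))"
    using pos by simp
  finally show False by simp
qed

text \<open>
  The list $w$ of length $j$ built after $j$ steps satisfies the invariant
  $\sum_x P(x)^d \le \sum_x P(x)^{d-j} \prod_{i<j} G_x(w_i)^K$ with $P(x) = \prod_i G_x(v_i)$: each
  step trades one factor $P$ for a $K$-th power of a single $G_x(v_b)$, where $b$ is one of the more
  than $K$ indices that can still extend $w$.
\<close>

lemma greedy_selection:
  fixes G :: "'x \<Rightarrow> 'a \<Rightarrow> real" and ind :: "'a list \<Rightarrow> bool"
  assumes G: "\<And>x y. x \<in> X \<Longrightarrow> 0 \<le> G x y" "\<And>x y. x \<in> X \<Longrightarrow> G x y \<le> 1"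
    and "K > 0" and "ind []"
  shows "(\<exists>w. ind w \<and> length w < d \<and> set w \<subseteq> set v \<and>
            card {i. i < length v \<and> ind (w @ [v ! i])} \<le> K) \<or>
         (\<exists>w. ind w \<and> length w = d \<and> set w \<subseteq> set v \<and>
            (\<Sum>x\<in>X. (\<Prod>i<length v. G x (v ! i)) ^ d) \<le> (\<Sum>x\<in>X. \<Prod>i<d. G x (w ! i) ^ K))"
    (is "?halt \<or> _")
proof (cases ?halt)
  case True
  then show ?thesis ..
next
  case False
  define P where "P = (\<lambda>x. \<Prod>i<length v. G x (v ! i))"
  have P0: "P x \<ge> 0" if "x \<in> X" for x
    using G that by (simp add: P_def prod_nonneg)
  have step: "\<exists>w. ind w \<and> length w = j \<and> set w \<subseteq> set v \<and>
      (\<Sum>x\<in>X. P x ^ d) \<le> (\<Sum>x\<in>X. P x ^ (d - j) * (\<Prod>i<j. G x (w ! i) ^ K))" if "j \<le> d" for j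
    using that
  proof (induction j)
    case 0
    then show ?case using \<open>ind []\<close> by (intro exI[of _ "[]"]) simp
  next
    case (Suc j)
    obtain w where w: "ind w" "length w = j" "set w \<subseteq> set v"
      "(\<Sum>x\<in>X. P x ^ d) \<le> (\<Sum>x\<in>X. P x ^ (d - j) * (\<Prod>i<j. G x (w ! i) ^ K))"
      using Suc.IH[OF Suc_leD[OF Suc.prems]] by (elim exE conjE) (rule that)
    define A where "A = {i. i < length v \<and> ind (w @ [v ! i])}"
    have "K < card A"
    proof (rule ccontr)
      assume "\<not> K < card A"
      then have "card {i. i < length v \<and> ind (w @ [v ! i])} \<le> K" by (simp add: A_def)
      moreover have "length w < d" using w(2) Suc.prems by simp
      ultimately show False using False w(1,3) by blast
    qed
    then obtain B where B: "B \<subseteq> A" "card B = K"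
      by (meson less_imp_le obtain_subset_with_card_n)
    have fin: "finite B" and Bne: "B \<noteq> {}" and BS: "B \<subseteq> {..<length v}"
      using B \<open>K > 0\<close> by (auto simp: A_def card_gt_0_iff)
    define g where "g = (\<lambda>x. P x ^ (d - Suc j) * (\<Prod>i<j. G x (w ! i) ^ K))"
    have g0: "g x \<ge> 0" if "x \<in> X" for x
      using G P0 that by (simp add: g_def prod_nonneg)
    have PB: "P x \<le> (\<Prod>i\<in>B. G x (v ! i))" if "x \<in> X" for x
    proof -
      have "P x = (\<Prod>i\<in>{..<length v} - B. G x (v ! i)) * (\<Prod>i\<in>B. G x (v ! i))"
        unfolding P_def using BS by (intro prod.subset_diff) auto
      also have "\<dots> \<le> 1 * (\<Prod>i\<in>B. G x (v ! i))"
        using G that by (intro mult_right_mono prod_le_1 prod_nonneg) auto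
      finally show ?thesis by simp
    qed
    have "(\<Sum>x\<in>X. P x ^ (d - j) * (\<Prod>i<j. G x (w ! i) ^ K)) = (\<Sum>x\<in>X. g x * P x)"
    proof -
      have "d - j = Suc (d - Suc j)" using Suc.prems by simp
      then show ?thesis by (simp add: g_def mult_ac)
    qed
    also have "\<dots> \<le> (\<Sum>x\<in>X. g x * (\<Prod>i\<in>B. G x (v ! i)))"
      using PB g0 by (intro sum_mono mult_left_mono)
    finally have le: "(\<Sum>x\<in>X. P x ^ d) \<le> (\<Sum>x\<in>X. g x * (\<Prod>i\<in>B. G x (v ! i)))"
      using w(4) by linarith
    obtain b where b: "b \<in> B" 
      "(\<Sum>x\<in>X. g x * (\<Prod>i\<in>B. G x (v ! i))) \<le> (\<Sum>x\<in>X. g x * G x (v ! b) ^ K)"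
      using exists_dominating_factor[OF fin Bne, of X "\<lambda>x i. G x (v ! i)" g] G(1) g0 B(2) by auto
    show ?case
    proof (intro exI[of _ "w @ [v ! b]"] conjI)
      show "ind (w @ [v ! b])" "set (w @ [v ! b]) \<subseteq> set v"
        using b(1) B(1) w(3) by (auto simp: A_def)
      show "length (w @ [v ! b]) = Suc j" using w(2) by simp
      have "(\<Prod>i<Suc j. G x ((w @ [v ! b]) ! i) ^ K) =
          (\<Prod>i<j. G x (w ! i) ^ K) * G x (v ! b) ^ K" for x
        using w(2) by (simp add: nth_append)
      then show "(\<Sum>x\<in>X. P x ^ d) \<le>
          (\<Sum>x\<in>X. P x ^ (d - Suc j) * (\<Prod>i<Suc j. G x ((w @ [v ! b]) ! i) ^ K))"
        using le b(2) by (simp add: g_def mult_ac)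
    qed
  qed
  show ?thesis
    using step[of d] by (simp add: P_def)
qed

section \<open>A trigonometric majorant of low degree\<close>

text \<open>
  The Fejer kernel $|\sum_{j<k} z^j|^2$ has the right size and degree, but it vanishes at the other
  $k$-th roots of unity. Rotating by $\omega$ with $\omega^k = -1$ moves the zeros halfway between
  the old ones, and the two numerators add up to a constant:
  $|1 - z^k|^2 + |1 + z^k|^2 = 4$ on the unit circle. The denominators $|1 - z|^2$ and
  $|1 - \omega z|^2$ agree up to a factor of $2$ and a term $O(1/k^2)$, since $|1 - \omega| \le \pi / k$.
\<close>

lemma geometric_pair_lower_bound:
  fixes z :: complex
  assumes "norm z = 1" "k > 0"
  defines "\<omega> \<equiv> cis (pi / real k)"
  shows "2 \<le> ((real k)\<^sup>2 * (norm (1 - z))\<^sup>2 + 16) *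
     (((norm (\<Sum>j<k. z ^ j))\<^sup>2 + (norm (\<Sum>j<k. (\<omega> * z) ^ j))\<^sup>2) / (real k)\<^sup>2)"
proof -
  define y where "y = (norm (1 - z))\<^sup>2"
  define D where "D = (norm (\<Sum>j<k. z ^ j))\<^sup>2"
  define D' where "D' = (norm (\<Sum>j<k. (\<omega> * z) ^ j))\<^sup>2"
  define M where "M = 2 * y + 32 / (real k)\<^sup>2"
  have \<omega>k: "\<omega> ^ k = -1"
    using assms(2) Complex.DeMoivre[of "pi / real k" k] by (simp add: \<omega>_def)
  have geom: "(norm (1 - u ^ k))\<^sup>2 = (norm (1 - u))\<^sup>2 * (norm (\<Sum>j<k. u ^ j))\<^sup>2" for u :: complex
    by (simp add: one_diff_power_eq norm_mult power_mult_distrib)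
  have "(norm (1 - z ^ k))\<^sup>2 + (norm (1 + z ^ k))\<^sup>2 = 2 * (1 + (norm (z ^ k))\<^sup>2)"
    unfolding cmod_power2 by (simp add: power2_eq_square algebra_simps)
  also have "\<dots> = 4"
    using assms(1) by (simp add: norm_power)
  finally have four: "4 = y * D + (norm (1 - \<omega> * z))\<^sup>2 * D'"
    using geom[of z] geom[of "\<omega> * z"] by (simp add: power_mult_distrib \<omega>k y_def D_def D'_def)
  have \<omega>1: "(norm (1 - \<omega>))\<^sup>2 \<le> 16 / (real k)\<^sup>2"
  proof -
    have "norm (\<omega> - 1) = 2 * \<bar>sin ((pi / real k) / 2)\<bar>"
      unfolding \<omega>_def cis_conv_exp by (rule dist_exp_i_1)
    also have "\<dots> \<le> 2 * \<bar>(pi / real k) / 2\<bar>"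
      by (intro mult_left_mono abs_sin_x_le_abs_x) auto
    also have "\<dots> = pi / real k" by simp
    finally have "(norm (1 - \<omega>))\<^sup>2 \<le> (pi / real k)\<^sup>2"
      by (simp add: norm_minus_commute power_mono)
    also have "\<dots> \<le> 16 / (real k)\<^sup>2"
    proof -
      have "pi * pi \<le> 4 * 4"
        using pi_less_4 by (intro mult_mono) auto
      then show ?thesis
        by (simp add: power_divide divide_right_mono power2_eq_square)
    qed
    finally show ?thesis .
  qed
  have "(norm (1 - \<omega> * z))\<^sup>2 \<le> M"
  proof -
    have eq: "(1 - z) + (1 - \<omega>) * z = 1 - \<omega> * z" by (simp add: algebra_simps)
    have "norm (1 - \<omega> * z) \<le> norm (1 - z) + norm (1 - \<omega>)"
      using norm_triangle_ineq[of "1 - z" "(1 - \<omega>) * z"] assms(1)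
      unfolding eq by (simp add: norm_mult)
    then have "(norm (1 - \<omega> * z))\<^sup>2 \<le> (norm (1 - z) + norm (1 - \<omega>))\<^sup>2"
      by (simp add: power_mono)
    also have "\<dots> \<le> 2 * y + 2 * (norm (1 - \<omega>))\<^sup>2"
      using zero_le_power2[of "norm (1 - z) - norm (1 - \<omega>)"]
      by (simp add: y_def power2_eq_square algebra_simps)
    finally show ?thesis using \<omega>1 by (simp add: M_def)
  qed
  moreover have "y \<le> M" by (simp add: M_def y_def)
  ultimately have "4 \<le> M * D + M * D'"
    unfolding four by (intro add_mono mult_right_mono) (auto simp: D_def D'_def)
  also have "\<dots> = 2 * (((real k)\<^sup>2 * y + 16) * ((D + D') / (real k)\<^sup>2))"
    using assms(2) by (simp add: M_def field_simps)
  finally show ?thesis by (simp add: y_def D_def D'_def)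
qed

lemma damping_factor_bounds:
  fixes z :: complex
  assumes "norm z = 1" "0 \<le> \<beta>" "\<beta> \<le> 1 / 4"
  shows "0 \<le> 1 - \<beta> * (norm (1 - z))\<^sup>2" "1 - \<beta> * (norm (1 - z))\<^sup>2 \<le> 1"
proof -
  have "norm (1 - z) \<le> 2"
    using norm_triangle_ineq4[of 1 z] assms(1) by simp
  then have "(norm (1 - z))\<^sup>2 \<le> 2\<^sup>2" by (intro power_mono) auto
  then have "\<beta> * (norm (1 - z))\<^sup>2 \<le> 1 / 4 * 4"
    using assms by (intro mult_mono) auto
  then show "0 \<le> 1 - \<beta> * (norm (1 - z))\<^sup>2" by simp
  show "1 - \<beta> * (norm (1 - z))\<^sup>2 \<le> 1" using assms(2) by simp
qed

text \<open>
  With $Y = k^2 |1 - z|^2$, the left-hand side is at most $1 / (1 + \beta Y)$, while the kernel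
  decays no faster than $1 / (Y + 16)$; the constant $8 / \beta$ makes up for the difference.
\<close>

lemma power_le_kernel:
  fixes z :: complex
  assumes "norm z = 1" "k > 0" "0 < \<beta>" "\<beta> \<le> 1 / 4"
  defines "\<omega> \<equiv> cis (pi / real k)"
  shows "(1 - \<beta> * (norm (1 - z))\<^sup>2) ^ k\<^sup>2 \<le>
     8 / (\<beta> * (real k)\<^sup>2) * ((norm (\<Sum>j<k. z ^ j))\<^sup>2 + (norm (\<Sum>j<k. (\<omega> * z) ^ j))\<^sup>2)"
proof -
  define x where "x = \<beta> * (norm (1 - z))\<^sup>2"
  define Y where "Y = (real k)\<^sup>2 * (norm (1 - z))\<^sup>2"
  define S where "S = ((norm (\<Sum>j<k. z ^ j))\<^sup>2 + (norm (\<Sum>j<k. (\<omega> * z) ^ j))\<^sup>2) / (real k)\<^sup>2"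
  have Y0: "Y \<ge> 0" and S0: "S \<ge> 0" by (auto simp: Y_def S_def)
  have x1: "x \<le> 1" and x0: "x \<ge> 0"
    using damping_factor_bounds[of z \<beta>] assms(1-4) by (auto simp: x_def)
  \<comment> \<open>Bernoulli's inequality bounds $1 + k^2 x$ by $(1+x)^{k^2}$, and $(1-x)(1+x) \le 1$.\<close>
  have "(1 - x) ^ k\<^sup>2 * (1 + \<beta> * Y) \<le> 1"
  proof -
    have "1 + \<beta> * Y = 1 + real (k\<^sup>2) * x" by (simp add: x_def Y_def)
    also have "\<dots> \<le> (1 + x) ^ k\<^sup>2"
      using x0 by (intro Bernoulli_inequality) auto
    finally have "(1 - x) ^ k\<^sup>2 * (1 + \<beta> * Y) \<le> (1 - x) ^ k\<^sup>2 * (1 + x) ^ k\<^sup>2"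
      using x1 by (intro mult_left_mono) auto
    also have "\<dots> = ((1 - x) * (1 + x)) ^ k\<^sup>2" by (simp add: power_mult_distrib)
    also have "\<dots> \<le> 1"
      using x0 x1 by (intro power_le_one) (auto simp: algebra_simps abs_square_le_1 mult_le_one)
    finally show ?thesis .
  qed
  then have "(1 - x) ^ k\<^sup>2 \<le> 1 / (1 + \<beta> * Y)"
    using assms(1-4) Y0 by (simp add: field_simps add_pos_nonneg)
  also have "\<dots> \<le> 8 / \<beta> * S"
  proof -
    have "2 \<le> (Y + 16) * S"
      unfolding Y_def S_def \<omega>_def using assms(1,2) by (rule geometric_pair_lower_bound)
    also have "\<dots> \<le> (16 / \<beta> * (1 + \<beta> * Y)) * S"
    proof (intro mult_right_mono S0)
      have "16 \<le> 16 / \<beta>" using assms(1-4) by (simp add: field_simps)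
      moreover have "16 / \<beta> * (1 + \<beta> * Y) = 16 / \<beta> + 16 * Y"
        using assms(3) by (simp add: field_simps)
      ultimately show "Y + 16 \<le> 16 / \<beta> * (1 + \<beta> * Y)" using Y0 by linarith
    qed
    also have "\<dots> = 2 * (8 / \<beta> * S * (1 + \<beta> * Y))" by simp
    finally have "1 \<le> 8 / \<beta> * S * (1 + \<beta> * Y)" by linarith
    then show ?thesis
      using assms(1-4) Y0 by (simp add: pos_divide_le_eq add_pos_nonneg)
  qed
  also have "\<dots> = 8 / (\<beta> * (real k)\<^sup>2) * ((norm (\<Sum>j<k. z ^ j))\<^sup>2 + (norm (\<Sum>j<k. (\<omega> * z) ^ j))\<^sup>2)"
    by (simp add: S_def)
  finally show ?thesis by (simp add: x_def)
qed

section \<open>Means of products over dissociated tuples\<close>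

text \<open>
  Expanding the product gives one character for each choice of a term in every factor. Its mean
  over $\xi$ vanishes unless the chosen frequencies satisfy a linear relation modulo $N$ with the
  $u_i$, and by hypothesis only the choices with all frequencies zero do.
\<close>

lemma mean_prod_trig_poly:
  fixes c :: "'p \<Rightarrow> complex" and e :: "'p \<Rightarrow> int" and u :: "nat \<Rightarrow> int"
  assumes "N > 0" "finite P"
    and ind: "\<And>f i. f \<in> PiE {..<d} (\<lambda>_. P) \<Longrightarrow> int N dvd (\<Sum>i<d. e (f i) * u i) \<Longrightarrow> i < d \<Longrightarrow> e (f i) = 0"
  shows "(\<Sum>\<xi><N. \<Prod>i<d. \<Sum>p\<in>P. c p * root_char N (e p * (int \<xi> * u i))) =
    of_nat N * (\<Sum>p | p \<in> P \<and> e p = 0. c p) ^ d"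
proof -
  define s where "s = (\<lambda>f. \<Sum>i<d. e (f i) * u i)"
  let ?P0 = "{p. p \<in> P \<and> e p = 0}"
  have "(\<Sum>\<xi><N. \<Prod>i<d. \<Sum>p\<in>P. c p * root_char N (e p * (int \<xi> * u i))) =
      (\<Sum>\<xi><N. \<Sum>f\<in>PiE {..<d} (\<lambda>_. P). (\<Prod>i<d. c (f i)) * root_char N (int \<xi> * s f))"
  proof (rule sum.cong[OF refl])
    fix \<xi>
    have "(\<Prod>i<d. \<Sum>p\<in>P. c p * root_char N (e p * (int \<xi> * u i))) =
        (\<Sum>f\<in>PiE {..<d} (\<lambda>_. P). \<Prod>i<d. c (f i) * root_char N (e (f i) * (int \<xi> * u i)))"
      using assms(2) by (intro prod_sum_PiE) auto
    also have "\<dots> = (\<Sum>f\<in>PiE {..<d} (\<lambda>_. P). (\<Prod>i<d. c (f i)) * root_char N (int \<xi> * s f))"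
      by (simp add: s_def prod.distrib sum_distrib_left mult.left_commute flip: root_char_sum)
    finally show "(\<Prod>i<d. \<Sum>p\<in>P. c p * root_char N (e p * (int \<xi> * u i))) = \<dots>" .
  qed
  also have "\<dots> = (\<Sum>f\<in>PiE {..<d} (\<lambda>_. P). (\<Prod>i<d. c (f i)) * (\<Sum>\<xi><N. root_char N (int \<xi> * s f)))"
    by (subst sum.swap) (simp add: sum_distrib_left)
  also have "\<dots> = (\<Sum>f\<in>PiE {..<d} (\<lambda>_. ?P0). (\<Prod>i<d. c (f i)) * of_nat N)"
  proof (rule sum.mono_neutral_cong_right)
    show "finite (PiE {..<d} (\<lambda>_. P))" using assms(2) by (intro finite_PiE) auto
    show "PiE {..<d} (\<lambda>_. ?P0) \<subseteq> PiE {..<d} (\<lambda>_. P)" by (intro PiE_mono) auto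
    show "\<forall>f\<in>PiE {..<d} (\<lambda>_. P) - PiE {..<d} (\<lambda>_. ?P0).
        (\<Prod>i<d. c (f i)) * (\<Sum>\<xi><N. root_char N (int \<xi> * s f)) = 0"
    proof
      fix f assume f: "f \<in> PiE {..<d} (\<lambda>_. P) - PiE {..<d} (\<lambda>_. ?P0)"
      have "\<not> int N dvd s f"
      proof
        assume "int N dvd s f"
        then have "e (f i) = 0" if "i < d" for i
          using ind f that unfolding s_def by blast
        then have "f \<in> PiE {..<d} (\<lambda>_. ?P0)"
          using f by (auto simp: PiE_iff)
        then show False using f by blast
      qed
      then show "(\<Prod>i<d. c (f i)) * (\<Sum>\<xi><N. root_char N (int \<xi> * s f)) = 0"
        using assms(1) by (simp add: sum_root_char)
    qed
    fix f assume "f \<in> PiE {..<d} (\<lambda>_. ?P0)"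
    then have "s f = 0"
      unfolding s_def by (intro sum.neutral) (auto simp: PiE_iff)
    then show "(\<Prod>i<d. c (f i)) * (\<Sum>\<xi><N. root_char N (int \<xi> * s f)) = (\<Prod>i<d. c (f i)) * of_nat N"
      by simp
  qed
  also have "\<dots> = (\<Prod>i<d. \<Sum>p\<in>?P0. c p) * of_nat N"
    using assms(2) by (subst prod_sum_PiE) (auto simp: sum_distrib_right)
  finally show ?thesis by (simp add: mult.commute)
qed

lemma kernel_expansion:
  fixes \<omega> :: complex
  shows "of_real ((norm (\<Sum>j<k. root_char N y ^ j))\<^sup>2 + (norm (\<Sum>j<k. (\<omega> * root_char N y) ^ j))\<^sup>2) =
    (\<Sum>p\<in>{..<k} \<times> {..<k}. (1 + \<omega> ^ fst p * cnj (\<omega> ^ snd p)) * root_char N ((int (fst p) - int (snd p)) * y))"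
proof -
  have sq: "of_real ((norm (\<Sum>j<k. f j))\<^sup>2) = (\<Sum>p\<in>{..<k} \<times> {..<k}. f (fst p) * cnj (f (snd p)))"
    for f :: "nat \<Rightarrow> complex"
    by (simp add: complex_norm_square sum_product sum.cartesian_product case_prod_beta flip: of_real_power)
  have "root_char N ((int j - int l) * y) = root_char N y ^ j * cnj (root_char N y ^ l)" for j l
  proof -
    have "(int j - int l) * y = int j * y + - (int l * y)" by (simp add: algebra_simps)
    then show ?thesis
      by (simp only: root_char_add root_char_minus root_char_power)
  qed
  then show ?thesis
    unfolding of_real_add sq
    by (simp add: sum.distrib [symmetric] algebra_simps power_mult_distrib)
qed

text \<open>
  The constant term of the kernel collects the diagonal pairs $j = l$. There are $k$ of them, and
  each contributes $1 + |\omega^j|^2 = 2$.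
\<close>

lemma mean_prod_kernel_eq:
  fixes u :: "nat \<Rightarrow> int"
  assumes "N > 0" "norm \<omega> = 1"
    and ind: "\<And>m i. \<lbrakk>\<And>i. i < d \<Longrightarrow> \<bar>m i\<bar> \<le> int k; int N dvd (\<Sum>i<d. m i * u i); i < d\<rbrakk> \<Longrightarrow> m i = 0"
  shows "(\<Sum>\<xi><N. \<Prod>i<d. (norm (\<Sum>j<k. root_char N (int \<xi> * u i) ^ j))\<^sup>2 +
      (norm (\<Sum>j<k. (\<omega> * root_char N (int \<xi> * u i)) ^ j))\<^sup>2) = real N * (2 * real k) ^ d"
proof -
  let ?P = "{..<k} \<times> {..<k}" and ?e = "\<lambda>p. int (fst p) - int (snd p)"
  let ?c = "\<lambda>p. 1 + \<omega> ^ fst p * cnj (\<omega> ^ snd p)"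
  have "complex_of_real (\<Sum>\<xi><N. \<Prod>i<d. (norm (\<Sum>j<k. root_char N (int \<xi> * u i) ^ j))\<^sup>2 +
      (norm (\<Sum>j<k. (\<omega> * root_char N (int \<xi> * u i)) ^ j))\<^sup>2) =
      (\<Sum>\<xi><N. \<Prod>i<d. \<Sum>p\<in>?P. ?c p * root_char N (?e p * (int \<xi> * u i)))"
    by (simp only: of_real_sum of_real_prod kernel_expansion)
  also have "\<dots> = of_nat N * (\<Sum>p | p \<in> ?P \<and> ?e p = 0. ?c p) ^ d"
  proof (rule mean_prod_trig_poly)
    fix f i assume f: "f \<in> PiE {..<d} (\<lambda>_. ?P)" "int N dvd (\<Sum>i<d. ?e (f i) * u i)" "i < d"
    have "\<bar>?e (f i)\<bar> \<le> int k" if "i < d" for i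
    proof -
      have "f i \<in> ?P" using f(1) that by (auto simp: PiE_iff)
      then show ?thesis by (cases "f i") auto
    qed
    then show "?e (f i) = 0" using f(2,3) by (rule ind)
  qed (use assms in auto)
  also have "(\<Sum>p | p \<in> ?P \<and> ?e p = 0. ?c p) = (\<Sum>j<k. 2)"
  proof (rule sum.reindex_bij_witness[of _ "\<lambda>j. (j, j)" fst])
    fix p assume "p \<in> {p. p \<in> ?P \<and> ?e p = 0}"
    moreover have "\<omega> ^ j * cnj (\<omega> ^ j) = 1" for j
      using complex_norm_square[of "\<omega> ^ j"] assms(2) by (simp add: norm_power)
    ultimately show "2 = ?c p" by auto
  qed auto
  finally have "complex_of_real (\<Sum>\<xi><N. \<Prod>i<d. (norm (\<Sum>j<k. root_char N (int \<xi> * u i) ^ j))\<^sup>2 +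
      (norm (\<Sum>j<k. (\<omega> * root_char N (int \<xi> * u i)) ^ j))\<^sup>2) = of_real (real N * (2 * real k) ^ d)"
    by (simp add: mult.commute)
  then show ?thesis by (simp only: of_real_eq_iff)
qed

lemma mean_prod_power_le:
  fixes u :: "nat \<Rightarrow> int"
  assumes "N > 0" "k > 0" "0 < \<beta>" "\<beta> \<le> 1 / 4"
    and ind: "\<And>m i. \<lbrakk>\<And>i. i < d \<Longrightarrow> \<bar>m i\<bar> \<le> int k; int N dvd (\<Sum>i<d. m i * u i); i < d\<rbrakk> \<Longrightarrow> m i = 0"
  shows "(\<Sum>\<xi><N. \<Prod>i<d. (1 - \<beta> * (norm (1 - root_char N (int \<xi> * u i)))\<^sup>2) ^ k\<^sup>2) \<le>
    real N * (16 / (\<beta> * real k)) ^ d"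
proof -
  define \<omega> where "\<omega> = cis (pi / real k)"
  define A where "A = 8 / (\<beta> * (real k)\<^sup>2)"
  define T where "T = (\<lambda>\<xi> i. (norm (\<Sum>j<k. root_char N (int \<xi> * u i) ^ j))\<^sup>2 +
      (norm (\<Sum>j<k. (\<omega> * root_char N (int \<xi> * u i)) ^ j))\<^sup>2)"
  have "(\<Sum>\<xi><N. \<Prod>i<d. (1 - \<beta> * (norm (1 - root_char N (int \<xi> * u i)))\<^sup>2) ^ k\<^sup>2) \<le>
      (\<Sum>\<xi><N. \<Prod>i<d. A * T \<xi> i)"
    unfolding A_def T_def \<omega>_def using assms(2-4)
    by (intro sum_mono prod_mono conjI power_le_kernel zero_le_power damping_factor_bounds) auto
  also have "\<dots> = A ^ d * (\<Sum>\<xi><N. \<Prod>i<d. T \<xi> i)"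
    by (simp add: prod.distrib sum_distrib_left)
  also have "(\<Sum>\<xi><N. \<Prod>i<d. T \<xi> i) = real N * (2 * real k) ^ d"
    unfolding T_def using assms(1) by (rule mean_prod_kernel_eq) (use ind in \<open>auto simp: \<omega>_def\<close>)
  also have "A ^ d * (real N * (2 * real k) ^ d) = real N * (A * (2 * real k)) ^ d"
    by (simp add: power_mult_distrib)
  also have "A * (2 * real k) = 16 / (\<beta> * real k)"
    using assms by (simp add: A_def power2_eq_square field_simps)
  finally show ?thesis .
qed

section \<open>Dissociated tuples and the inverse theorem\<close>

lemma dissociated_map_of_int_iff:
  "dissociated (real k) (map real_of_int u) \<longleftrightarrow>
    (\<forall>m. (\<forall>i<length u. \<bar>m i\<bar> \<le> int k) \<longrightarrow> (\<Sum>i<length u. m i * u ! i) = 0 \<longrightarrow> (\<forall>i<length u. m i = 0))"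
proof -
  have bd: "- real k \<le> of_int x \<and> of_int x \<le> real k \<longleftrightarrow> \<bar>x\<bar> \<le> int k" for x :: int
    by linarith
  have eq: "(\<Sum>i<length (map real_of_int u). of_int (m i) * map real_of_int u ! i) = 0 \<longleftrightarrow>
      (\<Sum>i<length u. m i * u ! i) = 0" for m :: "nat \<Rightarrow> int"
  proof -
    have "(\<Sum>i<length (map real_of_int u). of_int (m i) * map real_of_int u ! i) =
      real_of_int (\<Sum>i<length u. m i * u ! i)"
      by simp
    then show ?thesis by (simp only: of_int_eq_0_iff)
  qed
  show ?thesis
    unfolding dissociated_def bd eq by auto
qed

text \<open>
  A relation for the extended tuple must involve $x$, since $w$ has none of its own; solving for $x$
  divides by the absolute value $\tau$ of its coefficient, and the sign goes into the other
  coefficients.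
\<close>

lemma not_dissociated_snocD:
  assumes w: "dissociated (real k) w" and wx: "\<not> dissociated (real k) (w @ [x])"
  shows "x \<in> (\<Union>\<tau>\<in>{1..k}. (1 / real \<tau>) *o Q_set w (real k))"
proof -
  obtain m :: "nat \<Rightarrow> int" where
    bd: "\<And>i. i < Suc (length w) \<Longrightarrow> - real k \<le> of_int (m i) \<and> of_int (m i) \<le> real k"
    and nz: "\<exists>i<Suc (length w). m i \<noteq> 0"
    and "(\<Sum>i<Suc (length w). of_int (m i) * (w @ [x]) ! i) = 0"
    using wx unfolding dissociated_def by auto
  then have rel: "(\<Sum>i<length w. of_int (m i) * w ! i) + of_int (m (length w)) * x = 0"
    by (simp add: nth_append)
  define n where "n = m (length w)"
  have "n \<noteq> 0"
  proof
    assume "n = 0"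
    with rel have "(\<Sum>i<length w. of_int (m i) * w ! i) = 0" by (simp add: n_def)
    moreover have "\<exists>i<length w. m i \<noteq> 0"
      using nz \<open>n = 0\<close> by (auto simp: n_def less_Suc_eq)
    ultimately show False
      using w bd unfolding dissociated_def by (meson less_SucI)
  qed
  define \<tau> where "\<tau> = nat \<bar>n\<bar>"
  have \<tau>: "\<tau> \<in> {1..k}" "real \<tau> = \<bar>of_int n\<bar>"
    using \<open>n \<noteq> 0\<close> bd[of "length w"] by (auto simp: \<tau>_def n_def)
  let ?q = "\<Sum>i<length w. of_int (- sgn n * m i) * w ! i"
  have "?q \<in> Q_set w (real k)"
    unfolding Q_set_def
  proof (intro CollectI exI[of _ "\<lambda>i. - sgn n * m i"] conjI refl allI impI)
    fix i assume "i < length w"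
    then have "- real k \<le> of_int (m i)" "of_int (m i) \<le> real k"
      using bd[of i] by auto
    then show "- real k \<le> of_int (- sgn n * m i)" "of_int (- sgn n * m i) \<le> real k"
      by (auto simp: sgn_if)
  qed
  then have "1 / real \<tau> * ?q \<in> (1 / real \<tau>) *o Q_set w (real k)"
    by (rule set_times_intro2)
  moreover have "1 / real \<tau> * ?q = x"
  proof -
    have "?q = - of_int (sgn n) * (\<Sum>i<length w. of_int (m i) * w ! i)"
      by (simp add: sum_distrib_left mult.assoc sum_negf)
    also have "\<dots> = of_int (sgn n) * of_int n * x"
      using rel by (simp add: n_def eq_neg_iff_add_eq_0 [symmetric])
    also have "\<dots> = real \<tau> * x"
      using \<tau>(2) by (simp add: sgn_if)
    finally show ?thesis using \<tau>(1) by simp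
  qed
  ultimately have "x \<in> (1 / real \<tau>) *o Q_set w (real k)"
    by (simp only:)
  then show ?thesis
    using \<tau>(1) by blast
qed

theorem theorem2p4:
  fixes \<mu> :: real and d :: nat
  assumes "0 < \<mu>" and "\<mu> \<le> 1" and "0 < d"
  shows "\<exists>C::real. C \<ge> 1 \<and>
    (\<forall>(k::nat) (v::int list). k \<ge> 2 \<longrightarrow> max_prob \<mu> v \<ge> C * real k powi (- int d) \<longrightarrow>
      (\<exists>w::real list. dissociated (real k) w \<and>
        length w \<le> d - 1 \<and> set w \<subseteq> real_of_int ` set v \<and>
        card {i. i < length v \<and>
          real_of_int (v ! i) \<notin> (\<Union>\<tau>\<in>{1..k}. (1 / real \<tau>) *o Q_set w (real k))} \<le> k\<^sup>2))"
proof (rule exI[of _ "(128 * real d / \<mu>) ^ d + 1"], intro conjI allI impI)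
  let ?C = "(128 * real d / \<mu>) ^ d + 1"
  show "1 \<le> ?C" using assms by simp
  fix k :: nat and v :: "int list"
  assume k: "2 \<le> k" and large: "?C * real k powi (- int d) \<le> max_prob \<mu> v"
  define \<beta> where "\<beta> = \<mu> / (8 * real d)"
  have \<beta>: "0 < \<beta>" "\<beta> \<le> 1 / 4"
  proof -
    have "1 \<le> real d" using assms by simp
    then show "0 < \<beta>" "\<beta> \<le> 1 / 4" using assms by (auto simp: \<beta>_def field_simps)
  qed
  define S where "S = (\<Sum>y\<leftarrow>v. \<bar>y\<bar>)"
  have S: "\<bar>y\<bar> \<le> S" if "y \<in> set v" for y
    unfolding S_def using that by (intro member_le_sum_list) auto
  have S0: "S \<ge> 0" unfolding S_def by (intro sum_list_nonneg) auto
  \<comment> \<open>So large that a combination of the numbers $2 w_i$, with $w_i$ in $v$ and coefficients bounded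
    by $k$, vanishes as soon as it is divisible by $N$.\<close>
  define N where "N = nat (2 * int d * int k * S) + 1"
  have N0: "N > 0" and N: "2 * int d * int k * S < int N"
    using S0 by (auto simp: N_def)
  define G where "G = (\<lambda>\<xi> y. 1 - \<beta> * (norm (1 - root_char N (int \<xi> * (2 * y))))\<^sup>2)"
  define ind where "ind = (\<lambda>u. dissociated (real k) (map real_of_int u))"
  have max: "max_prob \<mu> v \<le> (\<Sum>\<xi><N. (\<Prod>i<length v. G \<xi> (v ! i)) ^ d) / real N"
  proof -
    have "max_prob \<mu> v \<in> range (walk_prob \<mu> v)"
      unfolding max_prob_def using assms by (intro Max_in finite_range_walk_prob) auto
    then show ?thesis
      using walk_prob_le_power_mean[OF assms N0] by (auto simp: G_def \<beta>_def)
  qed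
  have "(\<exists>u. ind u \<and> length u < d \<and> set u \<subseteq> set v \<and>
            card {i. i < length v \<and> ind (u @ [v ! i])} \<le> k\<^sup>2) \<or>
         (\<exists>u. ind u \<and> length u = d \<and> set u \<subseteq> set v \<and>
            (\<Sum>\<xi>\<in>{..<N}. (\<Prod>i<length v. G \<xi> (v ! i)) ^ d) \<le> (\<Sum>\<xi>\<in>{..<N}. \<Prod>i<d. G \<xi> (u ! i) ^ k\<^sup>2))"
  proof (rule greedy_selection)
    show "ind []" by (simp add: ind_def dissociated_def)
    show "0 < k\<^sup>2" using k by simp
    show "0 \<le> G \<xi> y" "G \<xi> y \<le> 1" for \<xi> y
      unfolding G_def using \<beta> by (intro damping_factor_bounds; simp)+
  qed
  then show "\<exists>w::real list. dissociated (real k) w \<and>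
        length w \<le> d - 1 \<and> set w \<subseteq> real_of_int ` set v \<and>
        card {i. i < length v \<and>
          real_of_int (v ! i) \<notin> (\<Union>\<tau>\<in>{1..k}. (1 / real \<tau>) *o Q_set w (real k))} \<le> k\<^sup>2"
  proof (elim disjE exE conjE)
    fix u assume u: "ind u" "length u < d" "set u \<subseteq> set v"
      "card {i. i < length v \<and> ind (u @ [v ! i])} \<le> k\<^sup>2"
    let ?w = "map real_of_int u"
    have "card {i. i < length v \<and>
          real_of_int (v ! i) \<notin> (\<Union>\<tau>\<in>{1..k}. (1 / real \<tau>) *o Q_set ?w (real k))} \<le>
        card {i. i < length v \<and> ind (u @ [v ! i])}"
    proof (rule card_mono)
      show "{i. i < length v \<and>
          real_of_int (v ! i) \<notin> (\<Union>\<tau>\<in>{1..k}. (1 / real \<tau>) *o Q_set ?w (real k))} \<subseteq>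
        {i. i < length v \<and> ind (u @ [v ! i])}"
        using not_dissociated_snocD[of k ?w] u(1) unfolding ind_def map_append list.map by blast
    qed simp
    then show ?thesis
      using u by (intro exI[of _ ?w]) (auto simp: ind_def)
  next
    fix u assume u: "ind u" "length u = d" "set u \<subseteq> set v"
      and le: "(\<Sum>\<xi>\<in>{..<N}. (\<Prod>i<length v. G \<xi> (v ! i)) ^ d) \<le> (\<Sum>\<xi>\<in>{..<N}. \<Prod>i<d. G \<xi> (u ! i) ^ k\<^sup>2)"
    have "(\<Sum>\<xi>\<in>{..<N}. \<Prod>i<d. G \<xi> (u ! i) ^ k\<^sup>2) \<le> real N * (16 / (\<beta> * real k)) ^ d"
      unfolding G_def
    proof (rule mean_prod_power_le)
      fix m :: "nat \<Rightarrow> int" and i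
      assume m: "\<And>i. i < d \<Longrightarrow> \<bar>m i\<bar> \<le> int k" and dvd: "int N dvd (\<Sum>i<d. m i * (2 * u ! i))" and i: "i < d"
      have "\<bar>\<Sum>i<d. m i * (2 * u ! i)\<bar> \<le> (\<Sum>i<d. \<bar>m i * (2 * u ! i)\<bar>)"
        by (rule sum_abs)
      also have "\<dots> \<le> (\<Sum>i<d. int k * (2 * S))"
      proof (rule sum_mono)
        fix i assume "i \<in> {..<d}"
        then have "u ! i \<in> set v" "\<bar>m i\<bar> \<le> int k"
          using m u(2,3) by auto
        then have "\<bar>m i\<bar> \<le> int k" "\<bar>u ! i\<bar> \<le> S"
          using S by auto
        then show "\<bar>m i * (2 * u ! i)\<bar> \<le> int k * (2 * S)"
          unfolding abs_mult by (intro mult_mono) auto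
      qed
      also have "\<dots> < int N" using N by (simp add: mult_ac)
      finally have "(\<Sum>i<d. m i * (2 * u ! i)) = 0"
        using dvd dvd_imp_le_int[of "\<Sum>i<d. m i * (2 * u ! i)" "int N"] by fastforce
      moreover have "(\<Sum>i<d. m i * (2 * u ! i)) = 2 * (\<Sum>i<d. m i * u ! i)"
        by (simp add: sum_distrib_left mult_ac)
      ultimately have "(\<Sum>i<d. m i * u ! i) = 0" by simp
      then show "m i = 0"
        using u(1,2) m i unfolding ind_def dissociated_map_of_int_iff by blast
    qed (use N0 k \<beta> in auto)
    with le have "(\<Sum>\<xi><N. (\<Prod>i<length v. G \<xi> (v ! i)) ^ d) / real N \<le>
        real N * (16 / (\<beta> * real k)) ^ d / real N"
      by (intro divide_right_mono) linarith+
    with max have "max_prob \<mu> v \<le> (16 / (\<beta> * real k)) ^ d"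
      using N0 by simp
    also have "\<dots> = (128 * real d / \<mu>) ^ d * real k powi (- int d)"
      using assms k by (simp add: \<beta>_def power_int_minus power_divide power_mult_distrib field_simps)
    also have "\<dots> < ?C * real k powi (- int d)"
      using k by (intro mult_strict_right_mono) auto
    finally show ?thesis using large by simp
  qed
qed

end
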